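(* Let $X$ be a separable normed space, let $\mathcal{I}$ be a non-trivial ideal on $\mathbb{N}$, and let $\{\omega_t\}_{t\in\mathbb{N}}$ be an $\mathcal{I}$-bounded weighted sequence. Suppose there exists a sequence $\{A_t\}_{t\in\mathbb{N}}$ of pairwise disjoint subsets of $\mathbb{N}$ such that $A_t\notin\mathcal{I}$ for every $t\in\mathbb{N}$. Then for every non-empty closed set $F\subseteq X$ there exists a sequence $\{x_t\}_{t\in\mathbb{N}}$ in $X$ such that $$F=\bigcap_{r>0}(\omega_t,\mathcal{I})\text{-}\Gamma_{x_t}^r.$$
   Context: A sequence $\{\omega_t\}_{t\in\mathbb{N}}$ of real numbers is a weighted sequence if there is $\beta>0$ with $\omega_t>\beta$ for all $t\in\mathbb{N}$. An ideal on $\mathbb{N}$ is a family $\mathcal{I}\subseteq\mathcal{P}(\mathbb{N})$ with $\varnothing\in\mathcal{I}$, closed under finite unions and under taking subsets; it is non-trivial if $\mathbb{N}\notin\mathcal{I}$. A weighted sequence $\{\omega_t\}$ is $\mathcal{I}$-bounded if there is $\mu>0$ with $\{t\in\mathbb{N}:\omega_t>\mu\}\in\mathcal{I}$. For a non-trivial ideal $\mathcal{I}$ and $r\ge0$, $(\omega_t,\mathcal{I})\text{-}\Gamma_{x_t}^r$ is the set of all $\gamma\in X$ such that $\{t\in\mathbb{N}:\omega_t\|x_t-\gamma\|<r+\varepsilon\}\notin\mathcal{I}$ for every $\varepsilon>0$. *)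

theory Defs
  imports "HOL-Analysis.Analysis"
begin

definition weighted_seq :: "(nat \<Rightarrow> real) \<Rightarrow> bool" where
  "weighted_seq \<omega> \<longleftrightarrow> (\<exists>\<beta>>0. \<forall>t. \<omega> t > \<beta>)"

definition ideal_on_nat :: "nat set set \<Rightarrow> bool" where
  "ideal_on_nat I \<longleftrightarrow> {} \<in> I \<and> (\<forall>A\<in>I. \<forall>B\<in>I. A \<union> B \<in> I) \<and> (\<forall>A\<in>I. \<forall>B\<subseteq>A. B \<in> I)"

definition nontrivial_ideal :: "nat set set \<Rightarrow> bool" where
  "nontrivial_ideal I \<longleftrightarrow> ideal_on_nat I \<and> UNIV \<notin> I"

definition ideal_bounded :: "nat set set \<Rightarrow> (nat \<Rightarrow> real) \<Rightarrow> bool" where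
  "ideal_bounded I \<omega> \<longleftrightarrow> (\<exists>\<mu>>0. {t. \<omega> t > \<mu>} \<in> I)"

text \<open>The set of weighted rough ideal cluster points of roughness degree \<open>r\<close>
  of the sequence \<open>x\<close>; only used for \<open>r \<ge> 0\<close> and non-trivial \<open>I\<close>.\<close>

definition rough_cluster_set ::
    "(nat \<Rightarrow> real) \<Rightarrow> nat set set \<Rightarrow> (nat \<Rightarrow> 'a::real_normed_vector) \<Rightarrow> real \<Rightarrow> 'a set" where
  "rough_cluster_set \<omega> I x r =
    {\<gamma>. \<forall>\<epsilon>>0. {t. \<omega> t * norm (x t - \<gamma>) < r + \<epsilon>} \<notin> I}"

end

theory Submission
  imports Defs
begin

text \<open>
  A subset of a separable normed space is separable, so \<open>F\<close> contains a sequence \<open>a\<close> that is dense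
  in it. Let \<open>x\<close> take the value \<open>a i\<close> throughout \<open>A i\<close>, and the value \<open>a 0\<close> outside all the \<open>A i\<close>.
  Two opposite inequalities then compare the weighted distances with the ordinary ones.

  \<^item> The weights are at most some \<open>\<mu>\<close> away from a set of the ideal. Every \<open>\<gamma> \<in> F\<close> has, for given
    \<open>r > 0\<close>, a point \<open>a i\<close> with \<open>\<mu> * norm (a i - \<gamma>) < r\<close>. Hence the weighted distance from \<open>x t\<close> to \<open>\<gamma>\<close>
    is below \<open>r\<close> for all \<open>t \<in> A i\<close> but those in a set of the ideal, and these \<open>t\<close> form a set outside
    the ideal (\<open>rough_cluster_point_of_dense_choice\<close>).
  \<^item> The weights exceed some \<open>\<beta> > 0\<close>. A point \<open>\<gamma>\<close> at positive distance from \<open>F\<close> is at weighted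
    distance bounded away from \<open>0\<close> from every \<open>x t\<close>, so for small \<open>r\<close> it is not a cluster point
    (\<open>rough_cluster_limit_subset_closed\<close>).
\<close>

text \<open>
  A countable dense set of the whole space may miss the subset \<open>F\<close>. It is therefore moved into \<open>F\<close>:
  each of its points \<open>c\<close> is replaced, at every scale at which \<open>F\<close> comes close to \<open>c\<close>, by a point of \<open>F\<close>
  that close to \<open>c\<close>.
\<close>

lemma separable_space_imp_dense_sequence_in_subset:
  fixes F :: "'a::metric_space set"
  assumes "separable_space (euclidean :: 'a topology)" and "F \<noteq> {}"
  obtains a :: "nat \<Rightarrow> 'a"
  where "range a \<subseteq> F" and "\<And>y e. y \<in> F \<Longrightarrow> e > 0 \<Longrightarrow> \<exists>i. dist (a i) y < e"
proof -
  obtain C :: "'a set" where C: "countable C" "closure C = UNIV"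
    using assms(1) by (auto simp: separable_space_def)
  obtain f0 where f0: "f0 \<in> F"
    using assms(2) by blast
  define near where "near c n y \<longleftrightarrow> y \<in> F \<and> dist c y < inverse (real (Suc n))" for c n y
  define p where "p = (\<lambda>(c, n). if \<exists>y. near c n y then SOME y. near c n y else f0)"
  define P where "P = p ` (C \<times> UNIV)"
  have near_p: "near c n (p (c, n))" if "near c n y" for c n y
    using that someI[of "near c n"] by (auto simp: p_def)
  have p_in: "p (c, n) \<in> F" for c n
    using near_p[of c n] f0 by (cases "\<exists>y. near c n y") (auto simp: near_def p_def)
  have "C \<noteq> {}"
    using C(2) by auto
  then have P: "countable P" "P \<noteq> {}"
    using C(1) by (auto simp: P_def)
  then have range_P: "range (from_nat_into P) = P"
    by (rule range_from_nat_into[rotated])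
  show ?thesis
  proof
    show "range (from_nat_into P) \<subseteq> F"
      unfolding range_P using p_in by (auto simp: P_def)
    fix y e assume y: "y \<in> F" and "e > (0::real)"
    then obtain n where n: "inverse (real (Suc n)) < e / 2"
      using reals_Archimedean[of "e / 2"] by auto
    obtain c where c: "c \<in> C" "dist c y < inverse (real (Suc n))"
      using C(2) closure_approachable[of y C]
      by (metis UNIV_I inverse_positive_iff_positive of_nat_0_less_iff zero_less_Suc)
    then have "dist c (p (c, n)) < inverse (real (Suc n))"
      using near_p[of c n y] y by (simp add: near_def)
    then have "dist (p (c, n)) y < e"
      using dist_triangle3[of "p (c, n)" y c] c(2) n by linarith
    moreover have "p (c, n) \<in> range (from_nat_into P)"
      unfolding range_P using c(1) by (auto simp: P_def)
    ultimately show "\<exists>i. dist (from_nat_into P i) y < e"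
      by force
  qed
qed

lemma ideal_positive_superset_mod_ideal:
  assumes "ideal_on_nat I" "S \<notin> I" "N \<in> I" "S - N \<subseteq> T"
  shows "T \<notin> I"
proof
  assume "T \<in> I"
  then have "T \<union> N \<in> I"
    using assms(1,3) by (simp add: ideal_on_nat_def)
  moreover have "S \<subseteq> T \<union> N"
    using assms(4) by blast
  ultimately show False
    using assms(1,2) unfolding ideal_on_nat_def by blast
qed

text \<open>
  The degree \<open>r\<close> has to be positive: an approximant \<open>a i\<close> of \<open>\<gamma>\<close> chosen with weighted error below \<open>r\<close>
  serves every \<open>\<epsilon>\<close> at once.
\<close>

lemma rough_cluster_point_of_dense_choice:
  fixes x a :: "nat \<Rightarrow> 'a::real_normed_vector"
  assumes I: "ideal_on_nat I" and bounded: "ideal_bounded I \<omega>"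
    and A: "\<And>i. A i \<notin> I"
    and x: "\<And>i t. t \<in> A i \<Longrightarrow> x t = a i"
    and dense: "\<And>e. e > 0 \<Longrightarrow> \<exists>i. dist (a i) \<gamma> < e"
    and r: "r > 0"
  shows "\<gamma> \<in> rough_cluster_set \<omega> I x r"
proof -
  obtain \<mu> where \<mu>: "\<mu> > 0" "{t. \<omega> t > \<mu>} \<in> I"
    using bounded by (auto simp: ideal_bounded_def)
  obtain i where "dist (a i) \<gamma> < r / \<mu>"
    using dense[of "r / \<mu>"] \<mu>(1) r by auto
  then have i: "\<mu> * norm (a i - \<gamma>) < r"
    using \<mu>(1) by (simp add: dist_norm field_simps)
  have "{t. \<omega> t * norm (x t - \<gamma>) < r + \<epsilon>} \<notin> I" if "\<epsilon> > 0" for \<epsilon>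
  proof (rule ideal_positive_superset_mod_ideal[OF I A \<mu>(2)])
    show "A i - {t. \<omega> t > \<mu>} \<subseteq> {t. \<omega> t * norm (x t - \<gamma>) < r + \<epsilon>}"
    proof
      fix t assume t: "t \<in> A i - {t. \<omega> t > \<mu>}"
      then have "\<omega> t * norm (a i - \<gamma>) \<le> \<mu> * norm (a i - \<gamma>)"
        by (intro mult_right_mono) auto
      then show "t \<in> {t. \<omega> t * norm (x t - \<gamma>) < r + \<epsilon>}"
        using i t x that by auto
    qed
  qed
  then show ?thesis
    by (simp add: rough_cluster_set_def)
qed

lemma rough_cluster_limit_subset_closed:
  fixes x :: "nat \<Rightarrow> 'a::real_normed_vector"
  assumes "ideal_on_nat I" "weighted_seq \<omega>" "closed F" "range x \<subseteq> F"
  shows "(\<Inter>r\<in>{0<..}. rough_cluster_set \<omega> I x r) \<subseteq> F"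
proof
  fix \<gamma> assume \<gamma>: "\<gamma> \<in> (\<Inter>r\<in>{0<..}. rough_cluster_set \<omega> I x r)"
  show "\<gamma> \<in> F"
  proof (rule ccontr)
    assume "\<gamma> \<notin> F"
    then obtain d where d: "d > 0" "ball \<gamma> d \<subseteq> - F"
      using assms(3) open_contains_ball[of "- F"] by (auto simp: closed_def)
    obtain \<beta> where \<beta>: "\<beta> > 0" "\<And>t. \<omega> t > \<beta>"
      using assms(2) by (auto simp: weighted_seq_def)
    have far: "\<beta> * d \<le> \<omega> t * norm (x t - \<gamma>)" for t
    proof (rule mult_mono)
      have "x t \<notin> ball \<gamma> d"
        using d(2) assms(4) rangeI[of x t] by blast
      then show "d \<le> norm (x t - \<gamma>)"
        by (simp add: dist_norm norm_minus_commute)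
    qed (use \<beta> d in \<open>auto intro: less_imp_le less_trans\<close>)
    \<comment> \<open>Degree and tolerance split the gap \<open>\<beta> * d\<close> in two halves.\<close>
    define h where "h = \<beta> * d / 2"
    have "h > 0"
      using \<beta>(1) d(1) by (simp add: h_def)
    then have "{t. \<omega> t * norm (x t - \<gamma>) < h + h} \<notin> I"
      using \<gamma> unfolding rough_cluster_set_def by blast
    moreover have "{t. \<omega> t * norm (x t - \<gamma>) < h + h} = {}"
      using far by (auto simp: h_def not_less)
    ultimately show False
      using assms(1) by (simp add: ideal_on_nat_def)
  qed
qed

theorem theorem4p11:
  fixes I :: "nat set set"
    and \<omega> :: "nat \<Rightarrow> real"
    and A :: "nat \<Rightarrow> nat set"
    and F :: "'a::real_normed_vector set"
  assumes "separable_space (euclidean :: 'a topology)"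
    and "nontrivial_ideal I"
    and "weighted_seq \<omega>"
    and "ideal_bounded I \<omega>"
    and "disjoint_family A"
    and "\<And>t. A t \<notin> I"
    and "closed F"
    and "F \<noteq> {}"
  shows "\<exists>x :: nat \<Rightarrow> 'a. F = (\<Inter>r\<in>{0<..}. rough_cluster_set \<omega> I x r)"
proof -
  have I: "ideal_on_nat I"
    using assms(2) by (simp add: nontrivial_ideal_def)
  obtain a :: "nat \<Rightarrow> 'a" where a: "range a \<subseteq> F"
    and dense: "\<And>y e. y \<in> F \<Longrightarrow> e > 0 \<Longrightarrow> \<exists>i. dist (a i) y < e"
    using separable_space_imp_dense_sequence_in_subset[OF assms(1,8)] by metis
  define x where "x t = (if \<exists>i. t \<in> A i then a (THE i. t \<in> A i) else a 0)" for t
  have x: "x t = a i" if "t \<in> A i" for i t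
  proof -
    have "(THE i. t \<in> A i) = i"
      using that assms(5) by (intro the_equality) (auto simp: disjoint_family_on_def)
    then show ?thesis
      using that by (auto simp: x_def)
  qed
  have "range x \<subseteq> F"
    using a by (auto simp: x_def)
  then have "(\<Inter>r\<in>{0<..}. rough_cluster_set \<omega> I x r) \<subseteq> F"
    by (rule rough_cluster_limit_subset_closed[OF I assms(3,7)])
  moreover have "F \<subseteq> (\<Inter>r\<in>{0<..}. rough_cluster_set \<omega> I x r)"
    using rough_cluster_point_of_dense_choice[OF I assms(4,6) x dense] by auto
  ultimately show ?thesis
    by blast
qed

end
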